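(* Let $T$ be a tree on $n\geq 4$ vertices with $\operatorname{diam}(T)=2d+1$ for some positive integer $d$. Then the rank of the eccentricity matrix $\mathcal{E}(T)$ is $4$, and $\mathcal{E}(T)$ has exactly two positive and two negative eigenvalues; that is, the inertia of $\mathcal{E}(T)$ is $(2,2,n-4)$.
   Context: For a connected graph $G$ with distance function $d(u,v)$, the eccentricity of a vertex $u$ is $e(u)=\max_{v}d(u,v)$. The eccentricity matrix $\mathcal{E}(G)$ is the matrix indexed by $V(G)$ with $\mathcal{E}(G)_{uv}=d(u,v)$ if $d(u,v)=\min\{e(u),e(v)\}$, and $\mathcal{E}(G)_{uv}=0$ otherwise. The diameter $\operatorname{diam}(G)$ is the largest distance between two vertices. The inertia of a real symmetric matrix is the triple of the numbers of its positive, negative and zero eigenvalues (with multiplicity). *)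

theory Defs
  imports
    "Graph_Theory.Digraph_Component"
    "Jordan_Normal_Form.DL_Rank"
    "Jordan_Normal_Form.Char_Poly"
begin

text \<open>
  Finite simple graphs are the locale \<open>graph\<close> of the AFP entry Graph_Theory: an undirected
  edge is a pair of opposite arcs. That entry's \<open>tree\<close> is not usable for them, since an edge
  traversed forth and back counts as a \<open>cycle\<close>. In such a graph the cycles of the undirected
  graph are exactly the arc cycles of length at least 3.
\<close>

definition tree_graph :: "('a, 'b) pre_digraph \<Rightarrow> bool" where
  "tree_graph G \<longleftrightarrow> graph G \<and> Digraph_Component.connected G \<and>
     \<not> (\<exists>p. pre_digraph.cycle G p \<and> 3 \<le> length p)"

text \<open>Only meaningful when \<open>v\<close> is reachable from \<open>u\<close>, hence on connected graphs.\<close>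

definition distance :: "('a, 'b) pre_digraph \<Rightarrow> 'a \<Rightarrow> 'a \<Rightarrow> nat" where
  "distance G u v = (LEAST k. \<exists>p. pre_digraph.apath G u p v \<and> length p = k)"

definition eccentricity :: "('a, 'b) pre_digraph \<Rightarrow> 'a \<Rightarrow> nat" where
  "eccentricity G u = Max (distance G u ` verts G)"

definition diam :: "('a, 'b) pre_digraph \<Rightarrow> nat" where
  "diam G = Max {distance G u v | u v. u \<in> verts G \<and> v \<in> verts G}"

text \<open>
  Matrices have natural number indices, so \<open>vs\<close> lists the vertices (each exactly once) and
  row and column \<open>i\<close> belong to the vertex \<open>vs ! i\<close>.
\<close>

definition eccentricity_matrix :: "('a, 'b) pre_digraph \<Rightarrow> 'a list \<Rightarrow> real mat" where
  "eccentricity_matrix G vs = mat (length vs) (length vs) (\<lambda>(i, j).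
     let u = vs ! i; v = vs ! j
     in if distance G u v = min (eccentricity G u) (eccentricity G v)
        then real (distance G u v) else 0)"

text \<open>
  \<open>proots (char_poly A)\<close> is the multiset of the real eigenvalues with their algebraic
  multiplicities; for symmetric \<open>A\<close> these are all the eigenvalues.
\<close>

definition inertia :: "real mat \<Rightarrow> nat \<times> nat \<times> nat" where
  "inertia A =
     (size {#x \<in># proots (char_poly A). 0 < x#},
      size {#x \<in># proots (char_poly A). x < 0#},
      size {#x \<in># proots (char_poly A). x = 0#})"

end

theory Submission
  imports Defs
begin

text \<open>
  Removing the middle edge of a longest path splits the tree into two sides, and every vertex \<open>u\<close>
  lies at depth \<open>h u \<le> d\<close> below the end of that edge on its own side. Hence \<open>e(u) = h u + d + 1\<close>, and
  the entry at \<open>(u, v)\<close> is \<open>h u + h v + 1\<close> if \<open>u\<close> and \<open>v\<close> lie on different sides and one of them has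
  depth \<open>d\<close>, and \<open>0\<close> otherwise. So with \<open>p\<close>, \<open>x\<close> (on one side) and \<open>q\<close>, \<open>y\<close> (on the other), where \<open>p\<close>, \<open>q\<close>
  are \<open>h + d + 1\<close> on the depths below \<open>d\<close> and \<open>x\<close>, \<open>y\<close> are the indicators of depth \<open>d\<close>, the matrix is
  \<open>p y\<^sup>T + x q\<^sup>T + (2d + 1) x y\<^sup>T\<close> plus its transpose. These four vectors are orthogonal, and the nonzero
  eigenvalues are those of a 4x4 matrix, whose characteristic polynomial
  \<open>z\<^sup>4 - t z\<^sup>2 + D\<close> has the roots \<open>\<plusminus>a\<close>, \<open>\<plusminus>b\<close> with \<open>a, b > 0\<close>.
\<close>

section \<open>Distances in trees\<close>

lemma sym_relpow: "sym R \<Longrightarrow> (u, v) \<in> R ^^ k \<Longrightarrow> (v, u) \<in> R ^^ k"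
proof (induction k arbitrary: v)
  case (Suc k)
  then obtain w where "(u, w) \<in> R ^^ k" "(w, v) \<in> R" by auto
  with Suc show ?case by (meson relpow_Suc_I2 symD)
qed simp

text \<open>Trades arc lists for relation powers, which are concatenated by
  \<open>relpow_add\<close> and reversed by \<open>sym_relpow\<close>. The condition
  \<open>u \<in> verts G\<close> matters for \<open>k = 0\<close>, where the power is the identity
  on the whole type.\<close>

lemma (in wf_digraph) awalk_iff_relpow:
  "(\<exists>p. awalk u p v \<and> length p = k) \<longleftrightarrow> u \<in> verts G \<and> (u, v) \<in> arcs_ends G ^^ k"
proof (induction k arbitrary: u)
  case 0
  show ?case by (auto simp: awalk_Nil_iff)
next
  case (Suc k)
  have "(\<exists>p. awalk u p v \<and> length p = Suc k) \<longleftrightarrow>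
      (\<exists>e. e \<in> arcs G \<and> u = tail G e \<and> (\<exists>p. awalk (head G e) p v \<and> length p = k))"
  proof
    assume "\<exists>p. awalk u p v \<and> length p = Suc k"
    then obtain e p where "awalk u (e # p) v" "length p = k"
      by (auto simp: length_Suc_conv)
    then show "\<exists>e. e \<in> arcs G \<and> u = tail G e \<and> (\<exists>p. awalk (head G e) p v \<and> length p = k)"
      by (intro exI[of _ e]) (auto simp: awalk_Cons_iff)
  next
    assume "\<exists>e. e \<in> arcs G \<and> u = tail G e \<and> (\<exists>p. awalk (head G e) p v \<and> length p = k)"
    then obtain e p where "e \<in> arcs G" "u = tail G e" "awalk (head G e) p v" "length p = k"
      by blast
    then show "\<exists>p. awalk u p v \<and> length p = Suc k"
      by (intro exI[of _ "e # p"]) (simp add: awalk_Cons_iff)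
  qed
  also have "\<dots> \<longleftrightarrow> (\<exists>w. (u, w) \<in> arcs_ends G \<and> w \<in> verts G \<and> (w, v) \<in> arcs_ends G ^^ k)"
    unfolding Suc.IH by (auto simp: arcs_ends_conv)
  also have "\<dots> \<longleftrightarrow> u \<in> verts G \<and> (u, v) \<in> arcs_ends G ^^ Suc k"
    by (meson adj_in_verts relpow_Suc_D2 relpow_Suc_I2)
  finally show ?case .
qed

text \<open>Cutting out a closed subwalk only shortens a walk, so the minimum over
  \<open>apath\<close> in \<open>distance\<close> can be compared with arbitrary walks.\<close>

lemma (in wf_digraph) awalk_imp_apath_le:
  assumes "awalk u p v"
  shows "\<exists>q. apath u q v \<and> length q \<le> length p"
  using assms
proof (induction rule: awalk_to_apath_induct)
  case (path p)
  then show ?case by (auto simp: apath_def)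
next
  case (decomp p q r s)
  then have "length (q @ s) \<le> length p"
    by (auto elim!: awalk_cyc_decompE)
  with decomp show ?case by (meson order_trans)
qed

locale undirected_tree = graph G for G :: "('a, 'b) pre_digraph" +
  assumes connected: "Digraph_Component.connected G"
    and no_long_cycle: "cycle p \<Longrightarrow> length p < 3"
begin

abbreviation adj where "adj \<equiv> arcs_ends G"

lemma sym_adj: "sym adj"
  using sym_arcs by (simp add: symmetric_def)

lemma ex_apath:
  assumes "u \<in> verts G" "v \<in> verts G"
  shows "\<exists>p. apath u p v"
  using assms symmetric_connected_imp_strongly_connected[OF sym_arcs connected]
  unfolding reachable_apath[symmetric] by auto

lemma distance_le:
  assumes "u \<in> verts G" "(u, v) \<in> adj ^^ k"
  shows "distance G u v \<le> k"
proof -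
  from assms obtain p where "awalk u p v" "length p = k"
    using awalk_iff_relpow by blast
  then obtain q where "apath u q v" "length q \<le> k"
    using awalk_imp_apath_le by blast
  moreover from \<open>apath u q v\<close> have "distance G u v \<le> length q"
    unfolding distance_def by (intro Least_le[where k = "length q"] exI[of _ q]) simp
  ultimately show ?thesis by simp
qed

text \<open>With \<open>distance_le\<close>, this makes the distance the least \<open>k\<close> such
  that \<open>(u, v) \<in> adj ^^ k\<close>.\<close>

lemma relpow_distance:
  assumes "u \<in> verts G" "v \<in> verts G"
  shows "(u, v) \<in> adj ^^ distance G u v"
proof -
  obtain q where "apath u q v" using ex_apath[OF assms] by blast
  then have "\<exists>p. apath u p v \<and> length p = distance G u v"
    unfolding distance_def
    by (intro LeastI[where P = "\<lambda>k. \<exists>p. apath u p v \<and> length p = k" and k = "length q"]) auto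
  then have "\<exists>p. awalk u p v \<and> length p = distance G u v"
    using awalkI_apath by blast
  then show ?thesis
    using awalk_iff_relpow[of u v "distance G u v"] by simp
qed

lemma distance_self: "u \<in> verts G \<Longrightarrow> distance G u u = 0"
  using distance_le[of u u 0] by simp

lemma distance_sym:
  assumes "u \<in> verts G" "v \<in> verts G"
  shows "distance G u v = distance G v u"
proof -
  have "distance G u v \<le> distance G v u" if "u \<in> verts G" "v \<in> verts G" for u v
    using distance_le[OF that(1) sym_relpow[OF sym_adj relpow_distance[OF that(2,1)]]] .
  with assms show ?thesis by (meson antisym)
qed

lemma distance_triangle:
  assumes "u \<in> verts G" "v \<in> verts G" "w \<in> verts G"
  shows "distance G u w \<le> distance G u v + distance G v w"
  by (rule distance_le) (use assms relpow_distance in \<open>auto simp: relpow_add\<close>)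

section \<open>Cutting the tree at an edge\<close>

text \<open>When \<open>(a, b)\<close> is an arc, this is the component of \<open>a\<close> in the
  graph with that edge deleted, as both of its arcs are dropped.\<close>

definition side :: "'a \<Rightarrow> 'a \<Rightarrow> 'a set" where
  "side a b = {u. (a, u) \<in> (adj - {(a, b), (b, a)})\<^sup>*}"

lemma mem_side_self: "a \<in> side a b"
  by (simp add: side_def)

text \<open>A path from \<open>a\<close> to \<open>b\<close> avoiding the edge would close up with it to a cycle.\<close>
lemma other_end_notin_side:
  assumes "(a, b) \<in> adj"
  shows "b \<notin> side a b"
proof
  assume "b \<in> side a b"
  have "\<exists>p. awalk a p u \<and> (\<forall>e\<in>set p. (tail G e, head G e) \<notin> {(a, b), (b, a)})"
    if "(a, u) \<in> (adj - {(a, b), (b, a)})\<^sup>*" for u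
    using that
  proof induction
    case base
    have "awalk a [] a" using assms by (simp add: awalk_Nil_iff adj_in_verts)
    then show ?case by (metis empty_iff empty_set)
  next
    case (step u v)
    then obtain p where p: "awalk a p u" "\<forall>e\<in>set p. (tail G e, head G e) \<notin> {(a, b), (b, a)}"
      by blast
    obtain e where e: "e \<in> arcs G" "tail G e = u" "head G e = v"
      using step.hyps by blast
    then have "awalk a (p @ [e]) v"
      using p(1) arc_implies_awalk by auto
    moreover have "\<forall>e\<in>set (p @ [e]). (tail G e, head G e) \<notin> {(a, b), (b, a)}"
      using p(2) e step.hyps by auto
    ultimately show ?case by blast
  qed
  then obtain p where p: "awalk a p b" "\<forall>e\<in>set p. (tail G e, head G e) \<noteq> (a, b)"
    using \<open>b \<in> side a b\<close> unfolding side_def by blast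
  define q where "q = awalk_to_apath p"
  have q: "apath a q b" "\<forall>e\<in>set q. (tail G e, head G e) \<noteq> (a, b)"
    using p awalk_to_apath_subset[of a p b] apath_awalk_to_apath[of a p b] by (auto simp: q_def)
  have "a \<noteq> b" using assms adj_not_same by blast
  then have "q \<noteq> []" using q(1) by (auto simp: apath_Nil_iff)
  \<comment> \<open>A one-arc path from \<open>a\<close> to \<open>b\<close> would be the excluded
    arc. So \<open>q\<close> has at least two arcs, and the arc back from \<open>b\<close> to
    \<open>a\<close> closes it to a cycle of length at least 3.\<close>
  moreover have "q \<noteq> [e]" for e
    using q by (auto simp: apath_Cons_iff apath_Nil_iff)
  ultimately have "length q \<ge> 2"
    by (cases q rule: remdups_adj.cases) auto
  obtain e where e: "e \<in> arcs G" "tail G e = b" "head G e = a"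
    using assms sym_adj by (meson reachableE symD)
  have "cycle (e # q)"
    unfolding cycle_def using q(1) e by (intro exI[of _ b]) (auto simp: apath_def awalk_Cons_iff)
  from no_long_cycle[OF this] show False using \<open>length q \<ge> 2\<close> by simp
qed

lemma leaving_side:
  assumes "(u, v) \<in> adj" "u \<in> side a b" "v \<notin> side a b"
  shows "u = a \<and> v = b"
proof -
  \<comment> \<open>Any other arc would put \<open>v\<close> into the side as well. The pair
    \<open>(b, a)\<close> is then excluded because \<open>a\<close> lies in the side.\<close>
  have "(u, v) \<in> {(a, b), (b, a)}"
    using assms unfolding side_def by (auto intro: rtrancl_into_rtrancl)
  then show ?thesis using assms(3) mem_side_self by auto
qed

text \<open>The induction finds the first step that leaves the side, which goes from
  \<open>a\<close> to \<open>b\<close> by \<open>leaving_side\<close>. Later crossings, if any, stay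
  in the part of length \<open>j\<close>.\<close>

lemma relpow_leaving_side:
  assumes "(u, v) \<in> adj ^^ k" "u \<in> side a b" "v \<notin> side a b"
  shows "\<exists>i j. (u, a) \<in> adj ^^ i \<and> (b, v) \<in> adj ^^ j \<and> k = i + 1 + j"
  using assms
proof (induction k arbitrary: u)
  case 0
  then show ?case by simp
next
  case (Suc k)
  then obtain w where w: "(u, w) \<in> adj" "(w, v) \<in> adj ^^ k"
    by (meson relpow_Suc_D2)
  show ?case
  proof (cases "w \<in> side a b")
    case True
    then obtain i j where "(w, a) \<in> adj ^^ i" "(b, v) \<in> adj ^^ j" "k = i + 1 + j"
      using Suc w by blast
    moreover from this have "(u, a) \<in> adj ^^ Suc i" using w(1) by (meson relpow_Suc_I2)
    ultimately show ?thesis by (intro exI[of _ "Suc i"] exI[of _ j]) simp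
  next
    case False
    then have "u = a" "w = b" using leaving_side w(1) Suc.prems(2) by blast+
    then show ?thesis using w(2) by (intro exI[of _ 0] exI[of _ k]) auto
  qed
qed

text \<open>A shortest walk has to use the arc \<open>(a, b)\<close>, and its two remaining pieces
  bound the distances on the right. The converse is the triangle inequality.\<close>

lemma distance_across:
  assumes "(a, b) \<in> adj" "u \<in> verts G" "v \<in> verts G" "u \<in> side a b" "v \<notin> side a b"
  shows "distance G u v = distance G u a + 1 + distance G b v"
proof (rule antisym)
  have ab: "a \<in> verts G" "b \<in> verts G" using assms(1) adj_in_verts by blast+
  have "(u, v) \<in> adj ^^ distance G u v" using relpow_distance assms by blast
  from relpow_leaving_side[OF this assms(4,5)] obtain i j where
    "(u, a) \<in> adj ^^ i" "(b, v) \<in> adj ^^ j" "distance G u v = i + 1 + j"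
    by blast
  then show "distance G u a + 1 + distance G b v \<le> distance G u v"
    using distance_le[of u a i] distance_le[of b v j] ab assms(2) by simp
  have "distance G a b \<le> 1" using distance_le[of a b 1] ab assms(1) by auto
  then show "distance G u v \<le> distance G u a + 1 + distance G b v"
    using distance_triangle[of u a v] distance_triangle[of a b v] ab assms by linarith
qed

section \<open>Eccentricities in a tree of odd diameter\<close>

lemma eccentricity_eqI:
  assumes "v \<in> verts G" "distance G u v = k" "\<And>w. w \<in> verts G \<Longrightarrow> distance G u w \<le> k"
  shows "eccentricity G u = k"
  unfolding eccentricity_def by (rule Max_eqI) (use assms in auto)

lemma finite_distances: "finite {distance G u v |u v. u \<in> verts G \<and> v \<in> verts G}"
  by (rule finite_image_set2) auto

lemma distance_le_diam:
  "u \<in> verts G \<Longrightarrow> v \<in> verts G \<Longrightarrow> distance G u v \<le> diam G"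
  unfolding diam_def by (rule Max_ge[OF finite_distances]) auto

lemma diam_attained: "\<exists>u\<in>verts G. \<exists>v\<in>verts G. distance G u v = diam G"
proof -
  have "verts G \<noteq> {}" using connected by (auto simp: connected_conv)
  then have "diam G \<in> {distance G u v |u v. u \<in> verts G \<and> v \<in> verts G}"
    unfolding diam_def by (intro Max_in[OF finite_distances]) auto
  then show ?thesis by fastforce
qed

text \<open>\<open>A\<close> is one side of the middle edge of a longest path, and \<open>h\<close>
  is the depth below that edge. The last four facts come from the ends of the edge and of the path;
  they will make the four vectors nonzero.\<close>

lemma odd_diam_eccentricity:
  assumes D: "diam G = 2 * d + 1"
  obtains h :: "'a \<Rightarrow> nat" and A where
    "\<And>u. u \<in> verts G \<Longrightarrow> h u \<le> d"
    "\<And>u. u \<in> verts G \<Longrightarrow> eccentricity G u = h u + d + 1"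
    "\<And>u v. u \<in> verts G \<Longrightarrow> v \<in> verts G \<Longrightarrow> (u \<in> A) \<noteq> (v \<in> A) \<Longrightarrow> distance G u v = h u + h v + 1"
    "\<And>u v. u \<in> verts G \<Longrightarrow> v \<in> verts G \<Longrightarrow> (u \<in> A) = (v \<in> A) \<Longrightarrow> distance G u v \<le> h u + h v"
    "\<exists>u\<in>verts G \<inter> A. h u = 0" "\<exists>u\<in>verts G \<inter> A. h u = d"
    "\<exists>u\<in>verts G - A. h u = 0" "\<exists>u\<in>verts G - A. h u = d"
proof -
  obtain x y where xy: "x \<in> verts G" "y \<in> verts G" "distance G x y = 2 * d + 1"
    using diam_attained D by metis
  \<comment> \<open>Written so that the step after the first \<open>d\<close> ones is the middle
    edge.\<close>
  have "(x, y) \<in> adj ^^ (d + Suc d)"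
    using relpow_distance[OF xy(1,2)] xy(3) by (simp add: mult_2)
  then obtain a where a: "(x, a) \<in> adj ^^ d" "(a, y) \<in> adj ^^ Suc d"
    unfolding relpow_add by auto
  then obtain b where b: "(a, b) \<in> adj" "(b, y) \<in> adj ^^ d"
    by (meson relpow_Suc_D2)
  have ab: "a \<in> verts G" "b \<in> verts G" using b(1) adj_in_verts by blast+
  have le: "distance G x a \<le> d" "distance G b y \<le> d"
    using distance_le a b ab xy by blast+
  define A where "A = side a b"
  define h where "h u = (if u \<in> A then distance G u a else distance G u b)" for u
  have mem: "a \<in> A" "b \<notin> A"
    using mem_side_self other_end_notin_side[OF b(1)] by (auto simp: A_def)
  have across: "distance G u v = h u + 1 + h v"
    if "u \<in> verts G" "v \<in> verts G" "u \<in> A" "v \<notin> A" for u v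
    using distance_across[OF b(1) that[unfolded A_def]] that distance_sym[of b v] ab
    by (simp add: h_def A_def)
  have h0: "h a = 0" "h b = 0" using mem ab by (auto simp: h_def distance_self)
  \<comment> \<open>Otherwise the way from \<open>x\<close> to \<open>a\<close> passes through
    \<open>b\<close>, so \<open>x\<close> is within \<open>d - 1\<close> of \<open>b\<close> and
    \<open>distance G x y\<close> is at most \<open>2 * d - 1\<close>. The argument for
    \<open>y\<close> is symmetric.\<close>
  have x: "x \<in> A"
  proof (rule ccontr)
    assume "x \<notin> A"
    then have "distance G x b + 1 \<le> d"
      using across[OF ab(1) xy(1) mem(1)] h0 le(1) distance_sym[OF ab(1) xy(1)] by (simp add: h_def)
    then show False using distance_triangle[of x b y] xy ab le by simp
  qed
  have y: "y \<notin> A"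
  proof
    assume "y \<in> A"
    then have "distance G a y + 1 \<le> d"
      using across[OF xy(2) ab(2) _ mem(2)] h0 le(2) distance_sym[of y] ab xy by (simp add: h_def)
    then show False using distance_triangle[of x a y] xy ab le by simp
  qed
  have hxy: "h x = d" "h y = d"
    using across[OF xy(1,2) x y] xy le x y distance_sym[OF ab(2) xy(2)] by (auto simp: h_def)
  \<comment> \<open>A deeper vertex would be farther than the diameter from whichever of
    \<open>x\<close> and \<open>y\<close> lies on the other side.\<close>
  have h_le: "h u \<le> d" if "u \<in> verts G" for u
  proof (cases "u \<in> A")
    case True
    then show ?thesis using across[OF that xy(2) True y] distance_le_diam[OF that xy(2)] hxy D by simp
  next
    case False
    then show ?thesis using across[OF xy(1) that x False] distance_le_diam[OF xy(1) that] hxy D by simp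
  qed
  have opp: "distance G u v = h u + h v + 1"
    if "u \<in> verts G" "v \<in> verts G" "(u \<in> A) \<noteq> (v \<in> A)" for u v
    using across[of u v] across[of v u] that distance_sym[of u v] by auto
  have same: "distance G u v \<le> h u + h v"
    if "u \<in> verts G" "v \<in> verts G" "(u \<in> A) = (v \<in> A)" for u v
    using that ab distance_triangle[of u a v] distance_triangle[of u b v]
      distance_sym[of v a] distance_sym[of v b] by (auto simp: h_def)
  have ecc: "eccentricity G u = h u + d + 1" if u: "u \<in> verts G" for u
  proof -
    \<comment> \<open>\<open>z\<close> is \<open>x\<close> or \<open>y\<close>, whichever lies
      opposite to \<open>u\<close>.\<close>
    obtain z where z: "z \<in> verts G" "(u \<in> A) \<noteq> (z \<in> A)" "h z = d"
      using xy x y hxy by metis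
    show ?thesis
    proof (rule eccentricity_eqI[OF z(1)])
      show "distance G u z = h u + d + 1" using opp[OF u z(1,2)] z(3) by simp
      show "distance G u w \<le> h u + d + 1" if "w \<in> verts G" for w
        using opp[OF u that] same[OF u that] h_le[OF that] by linarith
    qed
  qed
  have ends: "\<exists>u\<in>verts G \<inter> A. h u = 0" "\<exists>u\<in>verts G \<inter> A. h u = d"
    "\<exists>u\<in>verts G - A. h u = 0" "\<exists>u\<in>verts G - A. h u = d"
    using ab mem h0 xy x y hxy by blast+
  show ?thesis
    by (rule that[OF h_le ecc opp same ends])
qed

end

section \<open>Characteristic polynomials and rank\<close>

lemma char_poly_four_block_upper_right_zero:
  fixes A :: "'a :: idom mat"
  assumes "A \<in> carrier_mat n n" "C \<in> carrier_mat m n" "D \<in> carrier_mat m m"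
  shows "char_poly (four_block_mat A (0\<^sub>m n m) C D) = char_poly A * char_poly D"
proof -
  have "char_poly_matrix (four_block_mat A (0\<^sub>m n m) C D) =
      four_block_mat (char_poly_matrix A) (0\<^sub>m n m) (map_mat (\<lambda>a. [:- a:]) C) (char_poly_matrix D)"
    using assms by (intro eq_matI) (auto simp: char_poly_matrix_def)
  then show ?thesis
    using assms by (simp add: char_poly_def det_four_block_mat_upper_right_zero[of _ n _ m])
qed

lemma char_poly_zero_mat: "char_poly (0\<^sub>m n n :: 'a :: idom mat) = [:0, 1:] ^ n"
proof -
  have "map (\<lambda>a. [:- a, 1:]) (diag_mat (0\<^sub>m n n :: 'a mat)) = replicate n [:0, 1:]"
    by (intro nth_equalityI) (auto simp: diag_mat_def)
  then show ?thesis
    using char_poly_upper_triangular[of "0\<^sub>m n n :: 'a mat" n] by (simp add: prod_list_replicate)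
qed

text \<open>\<open>?A\<close> and \<open>?B\<close> are block lower triangular and similar through
  the unipotent matrix \<open>?P\<close> with inverse \<open>?Q\<close>. The powers of the variable
  on both sides make a comparison of \<open>n\<close> with \<open>k\<close> unnecessary.\<close>

lemma char_poly_mult_swap:
  fixes U V :: "'a :: idom mat"
  assumes U: "U \<in> carrier_mat n k" and V: "V \<in> carrier_mat k n"
  shows "char_poly (U * V) * [:0, 1:] ^ k = [:0, 1:] ^ n * char_poly (V * U)"
proof -
  let ?A = "four_block_mat (U * V) (0\<^sub>m n k) V (0\<^sub>m k k)"
  let ?B = "four_block_mat (0\<^sub>m n n) (0\<^sub>m n k) V (V * U)"
  let ?P = "four_block_mat (1\<^sub>m n) U (0\<^sub>m k n) (1\<^sub>m k)"
  let ?Q = "four_block_mat (1\<^sub>m n) (- U) (0\<^sub>m k n) (1\<^sub>m k)"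
  have one: "four_block_mat (1\<^sub>m n) (0\<^sub>m n k) (0\<^sub>m k n) (1\<^sub>m k) = (1\<^sub>m (n + k) :: 'a mat)"
    by (intro eq_matI) auto
  have zero: "- 0\<^sub>m k k + (1\<^sub>m k :: 'a mat) = 1\<^sub>m k" "- U + U = 0\<^sub>m n k" "U + - U = 0\<^sub>m n k"
    "V * - U + V * U = 0\<^sub>m k k" "U * V * - U + U * (V * U) = 0\<^sub>m n k"
    using U V assoc_mult_mat[OF U V U] by (auto intro!: eq_matI)
  have "?P * ?Q = 1\<^sub>m (n + k)"
    using U V by (subst mult_four_block_mat[of _ n n _ k _ k]) (auto simp: one zero)
  moreover have "?Q * ?P = 1\<^sub>m (n + k)"
    using U V by (subst mult_four_block_mat[of _ n n _ k _ k]) (auto simp: one zero)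
  moreover have "?P * ?B = four_block_mat (U * V) (U * (V * U)) V (V * U)"
    using U V by (subst mult_four_block_mat[of _ n n _ k _ k]) auto
  moreover have "\<dots> * ?Q = ?A"
    using U V by (subst mult_four_block_mat[of _ n n _ k _ k]) auto
  ultimately have "similar_mat ?A ?B"
    using U V unfolding similar_mat_def similar_mat_wit_def
    by (intro exI[of _ ?P] exI[of _ ?Q]) (auto simp: Let_def)
  then have "char_poly ?A = char_poly ?B" by (rule char_poly_similar)
  then show ?thesis
    using U V by (simp add: char_poly_four_block_upper_right_zero char_poly_zero_mat)
qed

lemma det_2x2:
  fixes A :: "'a :: idom mat"
  assumes "A \<in> carrier_mat 2 2"
  shows "det A = A $$ (0,0) * A $$ (1,1) - A $$ (0,1) * A $$ (1,0)"
proof -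
  let ?m = "\<lambda>i j. mat 1 1 (\<lambda>_. A $$ (i, j))"
  have "A = four_block_mat (?m 0 0) (?m 0 1) (?m 1 0) (?m 1 1)"
    using assms by (intro eq_matI) (auto simp: less_Suc_eq numeral_2_eq_2)
  then have "det A = det (four_block_mat (?m 0 0) (?m 0 1) (?m 1 0) (?m 1 1))"
    by simp
  also have "\<dots> = det (?m 0 0 * ?m 1 1 - ?m 0 1 * ?m 1 0)"
    by (rule det_four_block_mat) (auto simp: scalar_prod_def mult.commute)
  also have "\<dots> = A $$ (0,0) * A $$ (1,1) - A $$ (0,1) * A $$ (1,0)"
    by (subst det_single) (auto simp: scalar_prod_def)
  finally show ?thesis .
qed

text \<open>The diagonal blocks of the characteristic matrix are \<open>z\<close> times the identity
  and commute with the others, so its determinant is that of \<open>z^2 - J * K\<close>. The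
  coefficients are the determinant and minus the trace of \<open>J * K\<close>.\<close>

lemma char_poly_antidiagonal_blocks:
  fixes J K :: "'a :: idom mat"
  assumes J: "J \<in> carrier_mat 2 2" and K: "K \<in> carrier_mat 2 2"
  defines "M \<equiv> J * K"
  shows "char_poly (four_block_mat (0\<^sub>m 2 2) J K (0\<^sub>m 2 2)) =
    [:M $$ (0,0) * M $$ (1,1) - M $$ (0,1) * M $$ (1,0), 0, - (M $$ (0,0) + M $$ (1,1)), 0, 1:]"
proof -
  let ?X = "[:0, 1:] \<cdot>\<^sub>m 1\<^sub>m 2 :: 'a poly mat"
  let ?m = "map_mat (\<lambda>a. [:- a:])"
  have "char_poly_matrix (four_block_mat (0\<^sub>m 2 2) J K (0\<^sub>m 2 2)) = four_block_mat ?X (?m J) (?m K) ?X"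
    using J K by (intro eq_matI) (auto simp: char_poly_matrix_def)
  then have "char_poly (four_block_mat (0\<^sub>m 2 2) J K (0\<^sub>m 2 2)) = det (?X * ?X - ?m J * ?m K)"
    unfolding char_poly_def using J K by (simp, intro det_four_block_mat) auto
  also have "?X * ?X - ?m J * ?m K = mat 2 2 (\<lambda>(i, j). (if i = j then [:0, 0, 1:] else 0) - [:M $$ (i, j):])"
    using J K unfolding M_def
    by (intro eq_matI) (auto simp: scalar_prod_def less_2_cases_iff numeral_2_eq_2)
  finally show ?thesis
    by (subst (asm) det_2x2) (auto simp: algebra_simps)
qed

text \<open>The quadratic in \<open>w = z^2\<close> has a nonnegative discriminant and positive
  roots; \<open>a\<close> and \<open>b\<close> are their square roots and may coincide.\<close>

lemma biquadratic_factor: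
  fixes t D :: real
  assumes "t > 0" "D > 0" "4 * D \<le> t\<^sup>2"
  obtains a b where "a > 0" "b > 0" "[:D, 0, - t, 0, 1:] = [:- a, 1:] * [:a, 1:] * ([:- b, 1:] * [:b, 1:])"
proof -
  define s where "s = sqrt (t\<^sup>2 - 4 * D)"
  have s: "0 \<le> s" "s\<^sup>2 = t\<^sup>2 - 4 * D" using assms by (auto simp: s_def)
  have "s < t" by (rule power2_less_imp_less) (use s assms in auto)
  define a b where "a = sqrt ((t + s) / 2)" and "b = sqrt ((t - s) / 2)"
  have ab: "a > 0" "b > 0" "a\<^sup>2 = (t + s) / 2" "b\<^sup>2 = (t - s) / 2"
    using s \<open>s < t\<close> assms by (auto simp: a_def b_def)
  have "a\<^sup>2 * b\<^sup>2 = (t\<^sup>2 - s\<^sup>2) / 4"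
    unfolding ab by (simp add: field_simps power2_eq_square)
  then have "a\<^sup>2 * b\<^sup>2 = D" by (simp add: s)
  moreover have "a\<^sup>2 + b\<^sup>2 = t" by (simp add: ab field_simps)
  ultimately have "[:D, 0, - t, 0, 1:] = [:- a, 1:] * [:a, 1:] * ([:- b, 1:] * [:b, 1:])"
    by (simp add: power2_eq_square algebra_simps)
  with ab that show thesis by blast
qed

text \<open>Coordinate \<open>r\<close> vanishes on the whole span of \<open>S\<close> but not at
  \<open>v\<close>.\<close>

lemma (in vec_space) lin_indpt_insert_pivot:
  assumes S: "S \<subseteq> carrier_vec n" "lin_indpt S" and "r < n" "\<And>w. w \<in> S \<Longrightarrow> w $ r = 0"
    and v: "v \<in> carrier_vec n" "v $ r \<noteq> 0"
  shows "lin_indpt (insert v S)" "v \<notin> S"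
proof -
  show "v \<notin> S" using assms by auto
  have "v \<notin> span S"
  proof
    assume "v \<in> span S"
    then obtain a B where "finite B" "B \<subseteq> S" "v = lincomb a B"
      unfolding span_def by auto
    then have "v $ r = (\<Sum>w\<in>B. a w * w $ r)"
      using S \<open>r < n\<close> by (subst lincomb_index[symmetric]) auto
    also have "\<dots> = 0" using \<open>B \<subseteq> S\<close> assms(4) by (intro sum.neutral) auto
    finally show False using v by simp
  qed
  then show "lin_indpt (insert v S)"
    using lin_dep_iff_in_span[OF S v(1) \<open>v \<notin> S\<close>] by auto
qed

section \<open>Sums of four orthogonal products\<close>

text \<open>The vectors have pairwise disjoint supports. This yields zero entries for the pivots in
  the rank proof and orthogonality for the inertia.\<close>

locale disjoint_pairing =
  fixes n :: nat and p x q y :: "nat \<Rightarrow> real" and c :: real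
  assumes disj: "i < n \<Longrightarrow> p i * x i = 0 \<and> p i * q i = 0 \<and> p i * y i = 0 \<and>
      x i * q i = 0 \<and> x i * y i = 0 \<and> q i * y i = 0"
    and nz: "\<exists>i<n. p i \<noteq> 0" "\<exists>i<n. x i \<noteq> 0" "\<exists>i<n. q i \<noteq> 0" "\<exists>i<n. y i \<noteq> 0"
begin

text \<open>The terms with \<open>c\<close> are merged into \<open>q\<close>, which leaves four
  outer products and hence rank at most 4.\<close>

definition pairing_mat :: "real mat" where
  "pairing_mat = mat n n (\<lambda>(i, j). p i * y j + y i * p j + x i * (q j + c * y j) + (q i + c * y i) * x j)"

lemma rank_pairing_mat: "vec_space.rank n pairing_mat = 4"
proof -
  interpret vec_space "TYPE(real)" n .
  have carrier: "pairing_mat \<in> carrier_mat n n" by (simp add: pairing_mat_def)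
  let ?o = "\<lambda>f g :: nat \<Rightarrow> real. mat n n (\<lambda>(i, j). f i * g j)"
  have rank1: "rank (?o f g) \<le> 1" for f g
    by (rule rank_le_1_product_entries[of _ n f g]) auto
  define F where "F = ?o p y + ?o y p + ?o x (\<lambda>j. q j + c * y j) + ?o (\<lambda>i. q i + c * y i) x"
  have "pairing_mat = F" by (rule eq_matI) (simp_all add: pairing_mat_def F_def)
  have "rank F \<le> rank (?o p y) + rank (?o y p) + rank (?o x (\<lambda>j. q j + c * y j)) +
      rank (?o (\<lambda>i. q i + c * y i) x)"
    unfolding F_def by (intro order.trans[OF rank_subadditive] add_mono order.refl) auto
  then have "rank F \<le> 4"
    using rank1[of p y] rank1[of y p] rank1[of x "\<lambda>j. q j + c * y j"]
      rank1[of "\<lambda>i. q i + c * y i" x] by linarith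
  with \<open>pairing_mat = F\<close> have "rank pairing_mat \<le> 4" by simp
  obtain i1 i2 i3 i4 where i: "i1 < n" "p i1 \<noteq> 0" "i2 < n" "x i2 \<noteq> 0" "i3 < n" "q i3 \<noteq> 0" "i4 < n" "y i4 \<noteq> 0"
    using nz by auto
  have z: "x i1 = 0" "q i1 = 0" "y i1 = 0" "p i2 = 0" "q i2 = 0" "y i2 = 0"
    "p i3 = 0" "x i3 = 0" "y i3 = 0" "p i4 = 0" "x i4 = 0" "q i4 = 0"
    using disj[of i1] disj[of i2] disj[of i3] disj[of i4] i by auto
  let ?c = "col pairing_mat"
  have ent: "?c j $ k = p k * y j + y k * p j + x k * (q j + c * y j) + (q k + c * y k) * x j"
    if "j < n" "k < n" for j k
    using that by (simp add: pairing_mat_def)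
  have car: "?c j \<in> carrier_vec n" if "j < n" for j
    using that carrier by (rule col_carrier_vec)
  have "lin_indpt {}" by (simp add: lin_dep_def)
  \<comment> \<open>Up to nonzero factors, columns \<open>i1\<close>, \<open>i3\<close>,
    \<open>i2\<close>, \<open>i4\<close> are \<open>y\<close>, \<open>x\<close>,
    \<open>q + c y\<close>, \<open>p + c x\<close>. Their pivot rows \<open>i4\<close>,
    \<open>i2\<close>, \<open>i3\<close>, \<open>i1\<close> lie in the supports of \<open>y\<close>,
    \<open>x\<close>, \<open>q\<close>, \<open>p\<close>, where the columns added before
    vanish.\<close>
  have s1: "lin_indpt {?c i1}"
    by (rule lin_indpt_insert_pivot[where r = i4]) (use i z car ent \<open>lin_indpt {}\<close> in auto)
  have s2: "lin_indpt {?c i3, ?c i1}" "?c i3 \<notin> {?c i1}"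
    by (rule lin_indpt_insert_pivot[where r = i2]; use i z car ent s1 in auto)+
  have s3: "lin_indpt {?c i2, ?c i3, ?c i1}" "?c i2 \<notin> {?c i3, ?c i1}"
    by (rule lin_indpt_insert_pivot[where r = i3]; use i z car ent s2 in auto)+
  have s4: "lin_indpt {?c i4, ?c i2, ?c i3, ?c i1}" "?c i4 \<notin> {?c i2, ?c i3, ?c i1}"
    by (rule lin_indpt_insert_pivot[where r = i1]; use i z car ent s3 in auto)+
  have "card {?c i4, ?c i2, ?c i3, ?c i1} \<le> rank pairing_mat"
    using i carrier by (intro rank_ge_card_indpt[OF carrier _ s4(1)]) (auto simp: cols_def)
  then have "4 \<le> rank pairing_mat" using s2(2) s3(2) s4(2) by simp
  with \<open>rank pairing_mat \<le> 4\<close> show ?thesis by simp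
qed

lemma inertia_pairing_mat: "inertia pairing_mat = (2, 2, n - 4)"
proof -
  define S where "S f g = (\<Sum>i<n. f i * g i)" for f g :: "nat \<Rightarrow> real"
  have orth: "S p x = 0" "S p q = 0" "S p y = 0" "S x q = 0" "S x y = 0" "S q y = 0"
    using disj by (auto simp: S_def intro!: sum.neutral)
  have pos: "S f f > 0" if "\<exists>i<n. f i \<noteq> 0" for f
  proof -
    from that obtain i where "i < n" "f i \<noteq> 0" by auto
    then show ?thesis unfolding S_def
      by (intro sum_pos2[of _ i]) (auto simp: not_square_less_zero zero_less_mult_iff)
  qed
  define P X Q Y where "P = S p p" and "X = S x x" and "Q = S q q" and "Y = S y y"
  have PXQY: "P > 0" "X > 0" "Q > 0" "Y > 0"
    using pos nz by (auto simp: P_def X_def Q_def Y_def)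
  have comm: "S f g = S g f" for f g by (simp add: S_def mult.commute)
  have orth': "S x p = 0" "S q p = 0" "S y p = 0" "S q x = 0" "S y x = 0" "S y q = 0"
    using orth comm by metis+
  have lin: "S (\<lambda>i. f i + c * g i) h = S f h + c * S g h" for f g h
    by (simp add: S_def algebra_simps sum.distrib sum_distrib_left)
  \<comment> \<open>A factorisation through dimension 4. Here one of the terms with \<open>c\<close>
    is grouped with \<open>p\<close>, and the rows of \<open>V\<close> are ordered so that
    orthogonality leaves only the two off-diagonal blocks of \<open>V * U\<close>.\<close>
  define U where "U = mat n 4 (\<lambda>(i, j). [p i, x i, q i, y i] ! j)"
  define V where "V = mat 4 n (\<lambda>(j, i). [y i, q i + c * y i, x i, p i + c * x i] ! j)"
  define J where "J = mat 2 2 (\<lambda>(i, j). [[0, Y], [Q, c * Y]] ! i ! j)"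
  define K where "K = mat 2 2 (\<lambda>(i, j). [[0, X], [P, c * X]] ! i ! j)"
  have sum4: "(\<Sum>k = 0..<4. f k) = f 0 + f 1 + f 2 + f (3 :: nat)" for f :: "nat \<Rightarrow> real"
    by (simp add: numeral_eq_Suc)
  have "pairing_mat = U * V"
    by (intro eq_matI) (auto simp: pairing_mat_def U_def V_def scalar_prod_def sum4 algebra_simps)
  have V_U: "(V * U) $$ (i, j) = S (\<lambda>k. [y k, q k + c * y k, x k, p k + c * x k] ! i)
      (\<lambda>k. [p k, x k, q k, y k] ! j)" if "i < 4" "j < 4" for i j
    using that by (simp add: U_def V_def scalar_prod_def S_def atLeast0LessThan)
  have less_4: "i < 4 \<longleftrightarrow> i = 0 \<or> i = 1 \<or> i = 2 \<or> i = (3 :: nat)" for i by auto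
  have "V * U = four_block_mat (0\<^sub>m 2 2) J K (0\<^sub>m 2 2)"
  proof (rule eq_matI)
    fix i j assume "i < dim_row (four_block_mat (0\<^sub>m 2 2) J K (0\<^sub>m 2 2))"
      "j < dim_col (four_block_mat (0\<^sub>m 2 2) J K (0\<^sub>m 2 2))"
    then have "i < 4" "j < 4" by (auto simp: J_def K_def)
    then show "(V * U) $$ (i, j) = four_block_mat (0\<^sub>m 2 2) J K (0\<^sub>m 2 2) $$ (i, j)"
      unfolding V_U[OF \<open>i < 4\<close> \<open>j < 4\<close>] unfolding less_4
      by (elim disjE; simp add: J_def K_def lin orth orth' P_def X_def Q_def Y_def)
  qed (auto simp: U_def V_def J_def K_def)
  \<comment> \<open>The trace of \<open>J * K\<close>. In its determinant the terms with
    \<open>c\<close> cancel, leaving \<open>P * Q * X * Y\<close>.\<close>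
  define t where "t = Y * P + (Q * X + c\<^sup>2 * X * Y)"
  have "char_poly (V * U) = [:P * Q * X * Y, 0, - t, 0, 1:]"
    unfolding \<open>V * U = _\<close> t_def
    by (subst char_poly_antidiagonal_blocks)
      (auto simp: J_def K_def scalar_prod_def numeral_2_eq_2 algebra_simps power2_eq_square)
  moreover obtain a b where ab: "a > 0" "b > 0"
    "[:P * Q * X * Y, 0, - t, 0, 1:] = [:- a, 1:] * [:a, 1:] * ([:- b, 1:] * [:b, 1:])"
  proof (rule biquadratic_factor[of t "P * Q * X * Y"])
    show "t > 0" "P * Q * X * Y > 0"
      using PXQY by (auto simp: t_def intro!: add_pos_nonneg)
    \<comment> \<open>The arithmetic-geometric mean inequality for \<open>Y * P\<close> and
      \<open>Q * X\<close>; the remaining summand of \<open>t\<close> is nonnegative.\<close>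
    have "4 * (P * Q * X * Y) \<le> (Y * P + Q * X)\<^sup>2"
      using zero_le_power2[of "Y * P - Q * X"] by (simp add: power2_eq_square algebra_simps)
    also have "\<dots> \<le> t\<^sup>2"
      unfolding t_def using PXQY by (intro power_mono) auto
    finally show "4 * (P * Q * X * Y) \<le> t\<^sup>2" .
  qed
  ultimately have cp: "char_poly pairing_mat * [:0, 1:] ^ 4 = [:0, 1:] ^ n * ([:- a, 1:] * [:a, 1:] * ([:- b, 1:] * [:b, 1:]))"
    using char_poly_mult_swap[of U n 4 V] \<open>pairing_mat = U * V\<close> by (simp add: U_def V_def)
  have "pairing_mat \<in> carrier_mat n n" by (simp add: pairing_mat_def)
  from degree_monic_char_poly[OF this] have "char_poly pairing_mat \<noteq> 0" by auto
  then have "proots (char_poly pairing_mat * [:0, 1:] ^ 4) = proots (char_poly pairing_mat) + repeat_mset 4 {#0#}"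
    by (subst proots_mult) (auto simp: proots_power)
  moreover have "proots ([:0, 1:] ^ n * ([:- a, 1:] * [:a, 1:] * ([:- b, 1:] * [:b, 1:]))) =
      repeat_mset n {#0#} + {#a, - a, b, - b#}"
    by (simp add: proots_mult proots_power del: mult_pCons_left mult_pCons_right)
  ultimately have roots: "proots (char_poly pairing_mat) + repeat_mset 4 {#0#} = repeat_mset n {#0#} + {#a, - a, b, - b#}"
    using cp by simp
  have rep: "size (filter_mset R (repeat_mset k {#0#})) = (if R 0 then k else 0)"
    for R and k :: nat
    by (induction k) auto
  \<comment> \<open>The padding zeros count only if \<open>R 0\<close>. For \<open>R\<close>
    selecting zero, this says that the multiplicity plus 4 is \<open>n\<close>, so
    \<open>n - 4\<close> is not truncated.\<close>
  have "size (filter_mset R (proots (char_poly pairing_mat))) + (if R 0 then 4 else 0) =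
      (if R 0 then n else 0) + size (filter_mset R {#a, - a, b, - b#})" for R
    using arg_cong[OF roots, of "\<lambda>M. size (filter_mset R M)"]
    by (simp only: filter_union_mset size_union rep)
  from this[of "\<lambda>x. 0 < x"] this[of "\<lambda>x. x < 0"] this[of "\<lambda>x. x = 0"] show ?thesis
    using ab by (simp add: inertia_def)
qed

end

section \<open>The eccentricity matrix as a pairing matrix\<close>

theorem theorem3p2:
  fixes T :: "('a, 'b) pre_digraph" and vs :: "'a list" and n d :: nat
  assumes "tree_graph T"
    and "card (verts T) = n" and "n \<ge> 4"
    and "d > 0" and "diam T = 2 * d + 1"
    and "distinct vs" and "set vs = verts T"
  shows "vec_space.rank n (eccentricity_matrix T vs) = 4
    \<and> inertia (eccentricity_matrix T vs) = (2, 2, n - 4)"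
proof -
  interpret undirected_tree T
    using \<open>tree_graph T\<close>
    by (auto simp: tree_graph_def undirected_tree_def undirected_tree_axioms_def not_le)
  obtain h :: "'a \<Rightarrow> nat" and A where
    h_le: "\<And>u. u \<in> verts T \<Longrightarrow> h u \<le> d" and
    ecc: "\<And>u. u \<in> verts T \<Longrightarrow> eccentricity T u = h u + d + 1" and
    opp: "\<And>u v. u \<in> verts T \<Longrightarrow> v \<in> verts T \<Longrightarrow> (u \<in> A) \<noteq> (v \<in> A) \<Longrightarrow> distance T u v = h u + h v + 1" and
    same: "\<And>u v. u \<in> verts T \<Longrightarrow> v \<in> verts T \<Longrightarrow> (u \<in> A) = (v \<in> A) \<Longrightarrow> distance T u v \<le> h u + h v" and
    ends: "\<exists>u\<in>verts T \<inter> A. h u = 0" "\<exists>u\<in>verts T \<inter> A. h u = d"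
      "\<exists>u\<in>verts T - A. h u = 0" "\<exists>u\<in>verts T - A. h u = d"
    by (fact odd_diam_eccentricity[OF \<open>diam T = 2 * d + 1\<close>])
  have len: "length vs = n"
    using distinct_card[OF \<open>distinct vs\<close>] assms(2,7) by simp
  have nth: "vs ! i \<in> verts T" if "i < n" for i
    using that len assms(7) nth_mem by blast
  have nonzero: "\<exists>i<n. f i \<noteq> 0" if "\<exists>u\<in>verts T. P u" "\<And>i. P (vs ! i) \<Longrightarrow> f i \<noteq> 0"
    for P and f :: "nat \<Rightarrow> real"
  proof -
    from that(1) obtain u where "u \<in> set vs" "P u" using assms(7) by auto
    then obtain i where "i < n" "P (vs ! i)" using len by (auto simp: in_set_conv_nth)
    then show ?thesis using that(2) by auto
  qed
  \<comment> \<open>\<open>h + d + 1\<close> is the entry between a vertex of depth \<open>h\<close>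
    and an opposite one of depth \<open>d\<close>. For two opposite vertices of depth
    \<open>d\<close> it is \<open>2 * d + 1\<close>, which is supplied by \<open>c\<close>
    instead.\<close>
  define inner where "inner S i = (if vs ! i \<in> S \<and> h (vs ! i) < d then real (h (vs ! i) + d + 1) else 0)" for S i
  define outer where "outer S i = (if vs ! i \<in> S \<and> h (vs ! i) = d then 1 else 0 :: real)" for S i
  define c where "c = real (2 * d + 1)"
  interpret disjoint_pairing n "inner A" "outer A" "inner (- A)" "outer (- A)" c
  proof
    \<comment> \<open>The vertex of depth 0 counts as inner because \<open>d > 0\<close>.\<close>
    show "\<exists>i<n. inner A i \<noteq> 0"
      by (rule nonzero[where P = "\<lambda>u. u \<in> A \<and> h u = 0"]) (use ends \<open>d > 0\<close> in \<open>auto simp: inner_def\<close>)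
    show "\<exists>i<n. outer A i \<noteq> 0"
      by (rule nonzero[where P = "\<lambda>u. u \<in> A \<and> h u = d"]) (use ends in \<open>auto simp: outer_def\<close>)
    show "\<exists>i<n. inner (- A) i \<noteq> 0"
      by (rule nonzero[where P = "\<lambda>u. u \<notin> A \<and> h u = 0"]) (use ends \<open>d > 0\<close> in \<open>auto simp: inner_def\<close>)
    show "\<exists>i<n. outer (- A) i \<noteq> 0"
      by (rule nonzero[where P = "\<lambda>u. u \<notin> A \<and> h u = d"]) (use ends in \<open>auto simp: outer_def\<close>)
  qed (auto simp: inner_def outer_def)
  have "eccentricity_matrix T vs = pairing_mat"
  proof (rule eq_matI)
    fix i j assume "i < dim_row pairing_mat" "j < dim_col pairing_mat"
    then have ij: "i < n" "j < n" by (simp_all add: pairing_mat_def)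
    define u v where "u = vs ! i" and "v = vs ! j"
    have uv: "u \<in> verts T" "v \<in> verts T" using nth ij by (simp_all add: u_def v_def)
    have "eccentricity_matrix T vs $$ (i, j) =
        (if distance T u v = min (h u) (h v) + d + 1 then real (distance T u v) else 0)"
      using ij uv by (simp add: eccentricity_matrix_def len ecc u_def v_def min_add_distrib_left)
    \<comment> \<open>On one side the distance is at most min + max, hence at most min +
      \<open>d\<close>, which misses the threshold. Across, it is min + max + 1, which meets it
      exactly when the maximum is \<open>d\<close>.\<close>
    also have "\<dots> = (if (u \<in> A) \<noteq> (v \<in> A) \<and> max (h u) (h v) = d then real (h u + h v + 1) else 0)"
    proof (cases "(u \<in> A) = (v \<in> A)")
      case True
      then show ?thesis
        using same[OF uv] h_le[OF uv(1)] h_le[OF uv(2)] by (auto simp: min_def)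
    next
      case False
      then show ?thesis
        using opp[OF uv] h_le[OF uv(1)] h_le[OF uv(2)] by (auto simp: min_def max_def)
    qed
    also have "\<dots> = pairing_mat $$ (i, j)"
    proof -
      have entry: "pairing_mat $$ (i, j) = inner A i * outer (- A) j + outer (- A) i * inner A j +
          outer A i * (inner (- A) j + c * outer (- A) j) + (inner (- A) i + c * outer (- A) i) * outer A j"
        using ij by (simp add: pairing_mat_def)
      show ?thesis
        using h_le[OF uv(1)] h_le[OF uv(2)]
        unfolding entry unfolding inner_def outer_def c_def u_def[symmetric] v_def[symmetric]
        by (auto simp: max_def)
    qed
    finally show "eccentricity_matrix T vs $$ (i, j) = pairing_mat $$ (i, j)" .
  qed (simp_all add: eccentricity_matrix_def pairing_mat_def len)
  then show ?thesis
    using rank_pairing_mat inertia_pairing_mat by simp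
qed

end
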